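(* Let $(\mathcal{C},\Delta,\epsilon)$ be a finite-dimensional coalgebra over $\mathbb{C}$, let $V_1,V_2,\dots$ be finite-dimensional complex vector spaces and $\phi_i:\mathcal{C}\to V_i$ ($i=1,2,\dots$) linear maps. Let $W$ be a finite-dimensional complex vector space and $\psi:\mathcal{C}^*\to\mathrm{End}(W)$ an injective representation of the algebra $\mathcal{C}^*$. Let $B$ be a basis of $\mathcal{C}$ with dual basis $\{\delta_x\}_{x\in B}$ of $\mathcal{C}^*$, and define $A_i=\sum_{x\in B}\phi_i(x)\otimes\psi(\delta_x)\in V_i\otimes\mathrm{End}(W)$. Then for every $x\in\mathcal{C}$ there exists a matrix $b(x)\in\mathrm{End}(W)$ such that for all $n\geq 1$, $$(\phi_1\otimes\cdots\otimes\phi_n)\circ\Delta^{n-1}(x)=\sum_{y_1,\dots,y_n\in B}\mathrm{Tr}\big(b(x)\,\psi(\delta_{y_1})\psi(\delta_{y_2})\cdots\psi(\delta_{y_n})\big)\,\phi_1(y_1)\otimes\cdots\otimes\phi_n(y_n),$$ i.e. $(\phi_1\otimes\cdots\otimes\phi_n)\circ\Delta^{n-1}(x)$ is the matrix product state with tensors $A_1,\dots,A_n$ and boundary matrix $b(x)$.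
   Context: A coalgebra is a vector space $\mathcal{C}$ with a coassociative linear map $\Delta:\mathcal{C}\to\mathcal{C}\otimes\mathcal{C}$, $(\Delta\otimes\mathrm{Id})\Delta=(\mathrm{Id}\otimes\Delta)\Delta$, and a counit $\epsilon\in\mathcal{C}^*$ with $(\epsilon\otimes\mathrm{Id})\Delta=(\mathrm{Id}\otimes\epsilon)\Delta=\mathrm{Id}$. $\Delta^{n-1}$ denotes the $(n-1)$-fold iterated coproduct $\mathcal{C}\to\mathcal{C}^{\otimes n}$ ($\Delta^0=\mathrm{Id}$). The dual $\mathcal{C}^*$ is an algebra with product $(fg)(x)=(f\otimes g)(\Delta(x))$ and unit $\epsilon$. *)

theory Defs
  imports "HOL-Analysis.Analysis" "HOL-Library.Function_Algebras"
begin

text \<open>Coordinate model. The coalgebra C is the space 'b => complex ('b a finite index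
type, so C is finite-dimensional); C^{tensor k} is modelled by coefficient functions
on lists of length k over 'b (coefficients w.r.t. the standard basis). Each V_i is the
space of functions 'v => complex supported on a finite set S i; the tensor product
V_1 (x) ... (x) V_n is modelled by functions on lists of length n, a pure tensor being
the pointwise product of coordinates.\<close>

definition cscale :: "complex \<Rightarrow> ('i \<Rightarrow> complex) \<Rightarrow> ('i \<Rightarrow> complex)" where
  "cscale c f = (\<lambda>i. c * f i)"

definition mscale :: "complex \<Rightarrow> complex^'w^'w \<Rightarrow> complex^'w^'w" where
  "mscale c M = (\<chi> i j. c * M $ i $ j)"

text \<open>standard basis vector e_d\<close>
definition ind :: "'b \<Rightarrow> ('b \<Rightarrow> complex)" where
  "ind d = (\<lambda>i. if i = d then 1 else 0)"

text \<open>(Delta (x) Id) and (Id (x) Delta) on C (x) C, as maps into C (x) C (x) C\<close>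
definition cop_left :: "(('b \<Rightarrow> complex) \<Rightarrow> ('b \<times> 'b \<Rightarrow> complex)) \<Rightarrow> ('b \<times> 'b \<Rightarrow> complex)
    \<Rightarrow> ('b \<times> 'b \<times> 'b \<Rightarrow> complex)" where
  "cop_left D t = (\<lambda>(a, b, c). \<Sum>d\<in>UNIV. t (d, c) * D (ind d) (a, b))"

definition cop_right :: "(('b \<Rightarrow> complex) \<Rightarrow> ('b \<times> 'b \<Rightarrow> complex)) \<Rightarrow> ('b \<times> 'b \<Rightarrow> complex)
    \<Rightarrow> ('b \<times> 'b \<times> 'b \<Rightarrow> complex)" where
  "cop_right D t = (\<lambda>(a, b, c). \<Sum>d\<in>UNIV. t (a, d) * D (ind d) (b, c))"

definition is_coalgebra :: "(('b::finite \<Rightarrow> complex) \<Rightarrow> ('b \<times> 'b \<Rightarrow> complex))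
    \<Rightarrow> (('b \<Rightarrow> complex) \<Rightarrow> complex) \<Rightarrow> bool" where
  "is_coalgebra D eps \<longleftrightarrow>
     Vector_Spaces.linear cscale cscale D \<and>
     Vector_Spaces.linear cscale (*) eps \<and>
     (\<forall>x. cop_left D (D x) = cop_right D (D x)) \<and>
     (\<forall>x. (\<lambda>c. \<Sum>a\<in>UNIV. eps (ind a) * D x (a, c)) = x) \<and>
     (\<forall>x. (\<lambda>a. \<Sum>c\<in>UNIV. D x (a, c) * eps (ind c)) = x)"

text \<open>iterated coproduct: cop_pow D n x = Delta^n x in C^{tensor (n+1)},
  defined by Delta^(n+1) = (Delta (x) Id^{(x) n}) o Delta^n\<close>
fun cop_pow :: "(('b::finite \<Rightarrow> complex) \<Rightarrow> ('b \<times> 'b \<Rightarrow> complex)) \<Rightarrow> nat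
    \<Rightarrow> ('b \<Rightarrow> complex) \<Rightarrow> ('b list \<Rightarrow> complex)" where
  "cop_pow D 0 x = (\<lambda>w. x (hd w))"
| "cop_pow D (Suc n) x =
     (\<lambda>w. \<Sum>d\<in>UNIV. cop_pow D n x (d # drop 2 w) * D (ind d) (w ! 0, w ! 1))"

text \<open>product in the dual algebra C^*: (f g)(x) = (f (x) g)(Delta x)\<close>
definition dual_mult :: "(('b::finite \<Rightarrow> complex) \<Rightarrow> ('b \<times> 'b \<Rightarrow> complex))
    \<Rightarrow> (('b \<Rightarrow> complex) \<Rightarrow> complex) \<Rightarrow> (('b \<Rightarrow> complex) \<Rightarrow> complex)
    \<Rightarrow> (('b \<Rightarrow> complex) \<Rightarrow> complex)" where
  "dual_mult D f g = (\<lambda>x. \<Sum>(a, b)\<in>UNIV. D x (a, b) * f (ind a) * g (ind b))"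

text \<open>the dual space C^* (linear functionals)\<close>
definition dual_space :: "(('b \<Rightarrow> complex) \<Rightarrow> complex) set" where
  "dual_space = {f. Vector_Spaces.linear cscale (*) f}"

text \<open>injective (unital) representation psi : C^* -> End(W), W = complex^'w\<close>
definition is_injective_rep :: "(('b::finite \<Rightarrow> complex) \<Rightarrow> ('b \<times> 'b \<Rightarrow> complex))
    \<Rightarrow> (('b \<Rightarrow> complex) \<Rightarrow> complex) \<Rightarrow> ((('b \<Rightarrow> complex) \<Rightarrow> complex) \<Rightarrow> complex^'w^'w) \<Rightarrow> bool" where
  "is_injective_rep D eps psi \<longleftrightarrow>
     (\<forall>f\<in>dual_space. \<forall>g\<in>dual_space. psi (\<lambda>x. f x + g x) = psi f + psi g) \<and>
     (\<forall>f\<in>dual_space. \<forall>c. psi (\<lambda>x. c * f x) = mscale c (psi f)) \<and>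
     (\<forall>f\<in>dual_space. \<forall>g\<in>dual_space. psi (dual_mult D f g) = psi f ** psi g) \<and>
     psi eps = mat 1 \<and>
     inj_on psi dual_space"

text \<open>(phi_1 (x) ... (x) phi_n) applied to t in C^{tensor n}\<close>
definition phi_tensor :: "(nat \<Rightarrow> ('b::finite \<Rightarrow> complex) \<Rightarrow> ('v \<Rightarrow> complex)) \<Rightarrow> nat
    \<Rightarrow> ('b list \<Rightarrow> complex) \<Rightarrow> ('v list \<Rightarrow> complex)" where
  "phi_tensor phi n t = (\<lambda>u. \<Sum>w\<in>{w. length w = n}.
       t w * (\<Prod>i<n. phi (Suc i) (ind (w ! i)) (u ! i)))"

text \<open>the matrix product state
  sum_{y_1..y_n in B} Tr(b psi(delta_{y_1}) ... psi(delta_{y_n})) phi_1(y_1) (x) ... (x) phi_n(y_n)\<close>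
definition mps :: "(nat \<Rightarrow> ('b \<Rightarrow> complex) \<Rightarrow> ('v \<Rightarrow> complex)) \<Rightarrow> ('b \<Rightarrow> complex) set
    \<Rightarrow> (('b \<Rightarrow> complex) \<Rightarrow> complex^'w^'w) \<Rightarrow> complex^'w^'w \<Rightarrow> nat \<Rightarrow> ('v list \<Rightarrow> complex)" where
  "mps phi B A bnd n = (\<lambda>u. \<Sum>ys\<in>{ys. set ys \<subseteq> B \<and> length ys = n}.
       trace (bnd ** foldr (\<lambda>y M. A y ** M) ys (mat 1))
       * (\<Prod>i<n. phi (Suc i) (ys ! i) (u ! i)))"

end

theory Submission
  imports Defs
begin

text \<open>Pairing the iterated coproduct of \<open>x\<close> with functionals \<open>f\<^sub>1, \<dots>, f\<^sub>n\<close> gives the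
  product \<open>f\<^sub>1 \<cdots> f\<^sub>n\<close> of the dual algebra evaluated at \<open>x\<close>. As \<open>\<psi>\<close> is linear and injective,
  the functional \<open>\<psi> f \<mapsto> f x\<close> on its image extends to a functional on all matrices, and
  every such functional is \<open>M \<mapsto> Tr (b M)\<close> for a matrix \<open>b\<close>; this \<open>b\<close> is the boundary
  matrix. Expanding every \<open>\<phi>\<^sub>i\<close> in the basis \<open>B\<close> with the dual basis \<open>\<delta>\<close>, the coefficient of
  \<open>\<phi>\<^sub>1 y\<^sub>1 \<otimes> \<dots> \<otimes> \<phi>\<^sub>n y\<^sub>n\<close> is \<open>(\<delta> y\<^sub>1 \<cdots> \<delta> y\<^sub>n) x = Tr (b \<psi>(\<delta> y\<^sub>1) \<cdots> \<psi>(\<delta> y\<^sub>n))\<close>.\<close>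

lemma vector_space_cscale: "vector_space (cscale :: complex \<Rightarrow> ('i \<Rightarrow> complex) \<Rightarrow> _)"
  by unfold_locales (auto simp: cscale_def fun_eq_iff algebra_simps)

lemma vector_space_complex_mult: "vector_space ((*) :: complex \<Rightarrow> complex \<Rightarrow> complex)"
  by unfold_locales (auto simp: algebra_simps)

lemma module_cscale: "module (cscale :: complex \<Rightarrow> ('i \<Rightarrow> complex) \<Rightarrow> _)"
  using vector_space_cscale by (simp add: module_iff_vector_space)

lemmas linear_map_add = module_hom.add[OF module_hom_linearI]
lemmas linear_map_scale = module_hom.scale[OF module_hom_linearI]
lemmas linear_map_sum = module_hom.sum[OF module_hom_linearI]

lemma sum_fun_apply: "(\<Sum>a\<in>A. f a) i = (\<Sum>a\<in>A. f a i :: 'b :: comm_monoid_add)"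
  by (induction A rule: infinite_finite_induct) auto

lemma sum_ind_expansion: "(x :: 'i::finite \<Rightarrow> complex) = (\<Sum>d\<in>UNIV. cscale (x d) (ind d))"
  by (auto simp: fun_eq_iff sum_fun_apply cscale_def ind_def if_distrib[of "(*) _"] cong: if_cong)

lemma linear_functional_expansion:
  assumes "Vector_Spaces.linear cscale (*) g"
  shows "g (x :: 'i::finite \<Rightarrow> complex) = (\<Sum>d\<in>UNIV. x d * g (ind d))"
  by (subst sum_ind_expansion) (simp add: linear_map_sum[OF assms] linear_map_scale[OF assms])

lemma finite_independent_cscale:
  assumes "module.independent cscale (B :: ('i::finite \<Rightarrow> complex) set)"
  shows "finite B"
proof -
  have "x \<in> module.span cscale (range ind)" for x :: "'i \<Rightarrow> complex"
  proof -
    have "(\<Sum>d\<in>UNIV. cscale (x d) (ind d)) \<in> module.span cscale (range ind)"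
      by (intro module.span_sum[OF module_cscale] module.span_scale[OF module_cscale]
          module.span_base[OF module_cscale]) auto
    then show ?thesis
      by (simp only: sum_ind_expansion[of x, symmetric])
  qed
  then show ?thesis
    using vector_space.independent_span_bound[OF vector_space_cscale, of "range ind" B] assms by auto
qed

lemma dual_basis_expansion:
  fixes B :: "('i::finite \<Rightarrow> complex) set"
  assumes fin: "finite B" and span: "module.span cscale B = UNIV"
    and dual: "\<And>y. y \<in> B \<Longrightarrow> delta y \<in> dual_space"
    and dual_eval: "\<And>y z. y \<in> B \<Longrightarrow> z \<in> B \<Longrightarrow> delta y z = (if y = z then 1 else 0)"
  shows "v = (\<Sum>y\<in>B. cscale (delta y v) y)"
proof -
  have "v \<in> range (\<lambda>u. \<Sum>y\<in>B. cscale (u y) y)"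
    using module.span_finite[OF module_cscale fin] span by auto
  then obtain u where u: "v = (\<Sum>y\<in>B. cscale (u y) y)"
    by auto
  have "delta z v = u z" if z: "z \<in> B" for z
  proof -
    have "Vector_Spaces.linear cscale (*) (delta z)"
      using dual[OF z] by (simp add: dual_space_def)
    then have "delta z v = (\<Sum>y\<in>B. u y * delta z y)"
      unfolding u by (simp add: linear_map_sum linear_map_scale)
    also have "\<dots> = (\<Sum>y\<in>B. if y = z then u y else 0)"
      by (rule sum.cong) (auto simp: dual_eval z)
    also have "\<dots> = u z"
      using fin z by simp
    finally show ?thesis .
  qed
  then show ?thesis
    using u by (metis (no_types, lifting) sum.cong)
qed

lemma sum_lists_length_Suc:
  assumes "finite A"
  shows "(\<Sum>ys\<in>{ys. set ys \<subseteq> A \<and> length ys = Suc n}. F ys)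
       = (\<Sum>a\<in>A. \<Sum>ys\<in>{ys. set ys \<subseteq> A \<and> length ys = n}. F (a # ys))"
proof -
  let ?L = "{ys. set ys \<subseteq> A \<and> length ys = n}"
  have lists_Suc: "{ys. set ys \<subseteq> A \<and> length ys = Suc n} = (\<lambda>(a, ys). a # ys) ` (A \<times> ?L)"
    by (auto simp: length_Suc_conv image_iff)
  have inj: "inj_on (\<lambda>(a, ys). a # ys) (A \<times> ?L)"
    by (auto simp: inj_on_def)
  show ?thesis
    unfolding lists_Suc sum.reindex[OF inj] by (simp add: sum.cartesian_product case_prod_beta)
qed

lemma sum_lists_UNIV_length_Suc:
  "(\<Sum>ys\<in>{ys :: 'a::finite list. length ys = Suc n}. F ys)
     = (\<Sum>a\<in>UNIV. \<Sum>ys\<in>{ys. length ys = n}. F (a # ys))"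
  using sum_lists_length_Suc[of "UNIV :: 'a set"] by simp

lemma prod_sum_eq_sum_lists:
  assumes "finite A"
  shows "(\<Prod>i<n. \<Sum>y\<in>A. f i y)
       = (\<Sum>ys\<in>{ys. set ys \<subseteq> A \<and> length ys = n}. \<Prod>i<n. f i (ys ! i) :: 'b::comm_semiring_1)"
proof (induction n arbitrary: f)
  case 0
  have "{ys. set ys \<subseteq> A \<and> length ys = 0} = {[]}" by auto
  then show ?case by simp
next
  case (Suc n)
  have "(\<Prod>i<Suc n. \<Sum>y\<in>A. f i y) = (\<Sum>y\<in>A. f 0 y) * (\<Prod>i<n. \<Sum>y\<in>A. f (Suc i) y)"
    by (simp add: prod.lessThan_Suc_shift del: prod.lessThan_Suc)
  also have "\<dots> = (\<Sum>a\<in>A. \<Sum>ys\<in>{ys. set ys \<subseteq> A \<and> length ys = n}. f 0 a * (\<Prod>i<n. f (Suc i) (ys ! i)))"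
    by (simp add: Suc.IH sum_distrib_left sum_distrib_right) (rule sum.swap)
  also have "\<dots> = (\<Sum>ys\<in>{ys. set ys \<subseteq> A \<and> length ys = Suc n}. \<Prod>i<Suc n. f i (ys ! i))"
    by (simp add: sum_lists_length_Suc[OF assms] prod.lessThan_Suc_shift del: prod.lessThan_Suc)
  finally show ?case .
qed

definition tensor_pairing :: "(('b \<Rightarrow> complex) \<Rightarrow> complex) list \<Rightarrow> ('b list \<Rightarrow> complex) \<Rightarrow> complex" where
  "tensor_pairing fs t =
     (\<Sum>w\<in>{w. length w = length fs}. t w * (\<Prod>i<length fs. (fs ! i) (ind (w ! i))))"

lemma tensor_pairing_Nil: "tensor_pairing [] t = t []"
  by (simp add: tensor_pairing_def)

lemma tensor_pairing_Cons:
  "tensor_pairing (f # fs) (t :: 'b::finite list \<Rightarrow> complex)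
     = (\<Sum>a\<in>UNIV. f (ind a) * tensor_pairing fs (\<lambda>r. t (a # r)))"
  by (simp add: tensor_pairing_def sum_lists_UNIV_length_Suc prod.lessThan_Suc_shift sum_distrib_left
      mult_ac del: prod.lessThan_Suc)

lemma tensor_pairing_sum:
  "tensor_pairing fs (\<lambda>r. \<Sum>d\<in>A. c d * t d r) = (\<Sum>d\<in>A. c d * tensor_pairing fs (t d))"
  by (simp add: tensor_pairing_def sum_distrib_left sum_distrib_right mult_ac sum.swap[of _ A])

lemma tensor_pairing_cop_pow_Suc:
  fixes D :: "('b::finite \<Rightarrow> complex) \<Rightarrow> ('b \<times> 'b \<Rightarrow> complex)"
  shows "tensor_pairing (f # g # fs) (cop_pow D (Suc n) x)
       = tensor_pairing (dual_mult D f g # fs) (cop_pow D n x)"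
proof -
  define T where "T d = tensor_pairing fs (\<lambda>r. cop_pow D n x (d # r))" for d
  have "tensor_pairing (f # g # fs) (cop_pow D (Suc n) x)
      = (\<Sum>(a, b)\<in>UNIV. \<Sum>d\<in>UNIV. f (ind a) * g (ind b) * D (ind d) (a, b) * T d)"
    by (simp add: tensor_pairing_Cons tensor_pairing_sum T_def sum_distrib_left
        sum.cartesian_product[symmetric] UNIV_Times_UNIV[symmetric] mult_ac del: UNIV_Times_UNIV)
  also have "\<dots> = (\<Sum>d\<in>UNIV. \<Sum>(a, b)\<in>UNIV. f (ind a) * g (ind b) * D (ind d) (a, b) * T d)"
    unfolding case_prod_beta by (rule sum.swap)
  also have "\<dots> = tensor_pairing (dual_mult D f g # fs) (cop_pow D n x)"
    by (simp add: tensor_pairing_Cons T_def dual_mult_def sum_distrib_left case_prod_beta mult_ac)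
  finally show ?thesis .
qed

lemma linear_dual_mult:
  assumes D: "Vector_Spaces.linear cscale cscale (D :: ('b::finite \<Rightarrow> complex) \<Rightarrow> ('b \<times> 'b \<Rightarrow> complex))"
  shows "Vector_Spaces.linear cscale (*) (dual_mult D f g)"
proof -
  have "D (x + y) p = D x p + D y p" "D (cscale c x) p = c * D x p" for x y c p
    using linear_map_add[OF D, of x y] linear_map_scale[OF D, of c x] by (simp_all add: cscale_def)
  then show ?thesis
    unfolding Vector_Spaces.linear_iff dual_mult_def
    by (auto simp: vector_space_cscale vector_space_complex_mult sum.distrib sum_distrib_left
        algebra_simps case_prod_beta)
qed

lemma foldl_dual_mult_in_dual_space:
  assumes "Vector_Spaces.linear cscale cscale D" and "f \<in> dual_space"
  shows "foldl (dual_mult D) f fs \<in> dual_space"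
  using assms(2)
proof (induction fs arbitrary: f)
  case (Cons g fs)
  then show ?case
    using linear_dual_mult[OF assms(1)] by (simp add: dual_space_def)
qed simp

lemma tensor_pairing_cop_pow:
  assumes D: "Vector_Spaces.linear cscale cscale D" and f: "Vector_Spaces.linear cscale (*) f"
  shows "tensor_pairing (f # fs) (cop_pow D (length fs) x) = foldl (dual_mult D) f fs x"
  using f
proof (induction fs arbitrary: f)
  case Nil
  then show ?case
    by (simp add: tensor_pairing_Cons tensor_pairing_Nil linear_functional_expansion[of f x] mult.commute)
next
  case (Cons g fs)
  then show ?case
    by (simp add: tensor_pairing_cop_pow_Suc linear_dual_mult[OF D] del: cop_pow.simps)
qed

lemma psi_foldl_dual_mult:
  assumes rep: "is_injective_rep D eps psi" and D: "Vector_Spaces.linear cscale cscale D"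
    and "f \<in> dual_space" and "set fs \<subseteq> dual_space"
  shows "psi (foldl (dual_mult D) f fs) = psi f ** foldr (\<lambda>g M. psi g ** M) fs (mat 1)"
  using assms(3,4)
proof (induction fs arbitrary: f)
  case (Cons g fs)
  have "dual_mult D f g \<in> dual_space"
    using linear_dual_mult[OF D] by (simp add: dual_space_def)
  moreover have "psi (dual_mult D f g) = psi f ** psi g"
    using rep Cons.prems by (simp add: is_injective_rep_def)
  ultimately show ?case
    using Cons by (simp add: matrix_mul_assoc)
qed simp

definition functional_of :: "('b::finite \<Rightarrow> complex) \<Rightarrow> ('b \<Rightarrow> complex) \<Rightarrow> complex" where
  "functional_of c = (\<lambda>y. \<Sum>d\<in>UNIV. c d * y d)"

lemma functional_of_in_dual_space: "functional_of c \<in> dual_space"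
  unfolding dual_space_def functional_of_def Vector_Spaces.linear_iff
  by (auto simp: vector_space_cscale vector_space_complex_mult cscale_def sum.distrib
      sum_distrib_left algebra_simps)

lemma functional_of_ind: "functional_of c (ind d) = c d"
  by (simp add: functional_of_def ind_def if_distrib[of "(*) _"] cong: if_cong)

lemma functional_of_add: "functional_of (c + c') = (\<lambda>y. functional_of c y + functional_of c' y)"
  by (simp add: functional_of_def fun_eq_iff sum.distrib algebra_simps)

lemma functional_of_scale: "functional_of (\<lambda>d. a * c d) = (\<lambda>y. a * functional_of c y)"
  by (simp add: functional_of_def fun_eq_iff sum_distrib_left algebra_simps)

lemma dual_space_eq_functional_of:
  assumes "g \<in> dual_space"
  shows "g = functional_of (\<lambda>d. g (ind d))"
proof
  fix y
  have "Vector_Spaces.linear cscale (*) g"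
    using assms by (simp add: dual_space_def)
  then show "g y = functional_of (\<lambda>d. g (ind d)) y"
    by (subst linear_functional_expansion) (simp_all add: functional_of_def mult.commute)
qed

lemma linear_functional_extend_along_injective:
  assumes P: "Vector_Spaces.linear cscale cscale (P :: ('a \<Rightarrow> complex) \<Rightarrow> ('c \<Rightarrow> complex))"
    and "inj P" and f: "Vector_Spaces.linear cscale (*) f"
  obtains l where "Vector_Spaces.linear cscale (*) l" and "\<And>c. l (P c) = f c"
proof -
  have "vector_space_pair (cscale :: complex \<Rightarrow> ('a \<Rightarrow> complex) \<Rightarrow> _) (cscale :: complex \<Rightarrow> ('c \<Rightarrow> complex) \<Rightarrow> _)"
    by (simp add: vector_space_pair_def vector_space_cscale)
  then obtain G where "Vector_Spaces.linear cscale cscale G" and "G \<circ> P = id"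
    using vector_space_pair.linear_injective_left_inverse P \<open>inj P\<close> by blast
  with f show ?thesis
    by (intro that[of "f \<circ> G"]) (auto simp: Vector_Spaces.linear_compose pointfree_idE)
qed

lemma trace_functional_matrix:
  fixes l :: "('w::finite \<times> 'w \<Rightarrow> complex) \<Rightarrow> complex"
  assumes "Vector_Spaces.linear cscale (*) l"
  shows "trace ((\<chi> j i. l (ind (i, j))) ** M) = l (\<lambda>(i, j). M $ i $ j)"
proof -
  have "l (\<lambda>(i, j). M $ i $ j) = (\<Sum>(i, j)\<in>UNIV. M $ i $ j * l (ind (i, j)))"
    by (subst linear_functional_expansion[OF assms]) (simp add: case_prod_beta)
  also have "\<dots> = (\<Sum>j\<in>UNIV. \<Sum>i\<in>UNIV. l (ind (i, j)) * M $ i $ j)"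
    by (subst sum.swap) (simp add: sum.cartesian_product[symmetric] UNIV_Times_UNIV[symmetric]
        mult.commute del: UNIV_Times_UNIV)
  finally show ?thesis
    by (simp add: trace_def matrix_matrix_mult_def)
qed

lemma exists_trace_boundary:
  fixes psi :: "(('b::finite \<Rightarrow> complex) \<Rightarrow> complex) \<Rightarrow> complex^'w::finite^'w"
  assumes rep: "is_injective_rep D eps psi"
  obtains bnd where "\<And>g. g \<in> dual_space \<Longrightarrow> trace (bnd ** psi g) = g x"
proof -
  have psi_add: "\<And>f g. f \<in> dual_space \<Longrightarrow> g \<in> dual_space \<Longrightarrow> psi (\<lambda>x. f x + g x) = psi f + psi g"
    and psi_scale: "\<And>f c. f \<in> dual_space \<Longrightarrow> psi (\<lambda>x. c * f x) = mscale c (psi f)"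
    and psi_inj: "inj_on psi dual_space"
    using rep by (auto simp: is_injective_rep_def)
  define P where "P c = (\<lambda>(i, j). psi (functional_of c) $ i $ j)" for c
  have "Vector_Spaces.linear cscale cscale P"
    unfolding Vector_Spaces.linear_iff
    by (simp add: vector_space_cscale P_def functional_of_add functional_of_scale
        psi_add psi_scale functional_of_in_dual_space fun_eq_iff mscale_def cscale_def)
  moreover have "inj P"
  proof (rule injI)
    fix c c' assume "P c = P c'"
    then have "psi (functional_of c) = psi (functional_of c')"
      by (auto simp: P_def fun_eq_iff vec_eq_iff)
    then have "functional_of c = functional_of c'"
      using psi_inj functional_of_in_dual_space by (auto dest: inj_onD)
    then show "c = c'"
      by (metis functional_of_ind ext)
  qed
  moreover have "Vector_Spaces.linear cscale (*) (\<lambda>c. functional_of c x)"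
    unfolding Vector_Spaces.linear_iff
    by (simp add: vector_space_cscale vector_space_complex_mult functional_of_add functional_of_scale
        cscale_def)
  ultimately obtain l where l: "Vector_Spaces.linear cscale (*) l" "\<And>c. l (P c) = functional_of c x"
    using linear_functional_extend_along_injective by blast
  show thesis
  proof (rule that)
    fix g :: "('b \<Rightarrow> complex) \<Rightarrow> complex" assume g: "g \<in> dual_space"
    have "trace ((\<chi> j i. l (ind (i, j))) ** psi g) = l (P (\<lambda>d. g (ind d)))"
      by (simp add: trace_functional_matrix[OF l(1)] P_def flip: dual_space_eq_functional_of[OF g])
    also have "\<dots> = g x"
      by (simp add: l(2) flip: dual_space_eq_functional_of[OF g])
    finally show "trace ((\<chi> j i. l (ind (i, j))) ** psi g) = g x" .
  qed
qed

lemma phi_tensor_dual_basis_expansion: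
  fixes B :: "('b::finite \<Rightarrow> complex) set"
  assumes fin: "finite B" and span: "module.span cscale B = UNIV"
    and dual: "\<And>y. y \<in> B \<Longrightarrow> delta y \<in> dual_space"
    and dual_eval: "\<And>y z. y \<in> B \<Longrightarrow> z \<in> B \<Longrightarrow> delta y z = (if y = z then 1 else 0)"
    and phi_lin: "\<And>i. i \<ge> 1 \<Longrightarrow> Vector_Spaces.linear cscale cscale (phi i)"
  shows "phi_tensor phi n t u = (\<Sum>ys\<in>{ys. set ys \<subseteq> B \<and> length ys = n}.
           tensor_pairing (map delta ys) t * (\<Prod>i<n. phi (Suc i) (ys ! i) (u ! i)))"
proof -
  let ?Bn = "{ys. set ys \<subseteq> B \<and> length ys = n}"
  have phi_ind: "phi (Suc i) (ind d) v = (\<Sum>y\<in>B. delta y (ind d) * phi (Suc i) y v)" for i d v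
  proof -
    have lin: "Vector_Spaces.linear cscale cscale (phi (Suc i))"
      using phi_lin by simp
    have "phi (Suc i) (ind d) = phi (Suc i) (\<Sum>y\<in>B. cscale (delta y (ind d)) y)"
      by (rule arg_cong[OF dual_basis_expansion[OF fin span dual dual_eval]])
    also have "\<dots> = (\<Sum>y\<in>B. cscale (delta y (ind d)) (phi (Suc i) y))"
      by (simp add: linear_map_sum[OF lin] linear_map_scale[OF lin])
    finally show ?thesis
      by (simp add: sum_fun_apply cscale_def)
  qed
  have "(\<Prod>i<n. phi (Suc i) (ind (w ! i)) (u ! i))
      = (\<Sum>ys\<in>?Bn. (\<Prod>i<n. delta (ys ! i) (ind (w ! i))) * (\<Prod>i<n. phi (Suc i) (ys ! i) (u ! i)))"
    for w
    by (simp add: phi_ind prod_sum_eq_sum_lists[OF fin] prod.distrib)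
  then have "phi_tensor phi n t u = (\<Sum>w\<in>{w. length w = n}. \<Sum>ys\<in>?Bn.
      t w * (\<Prod>i<n. delta (ys ! i) (ind (w ! i))) * (\<Prod>i<n. phi (Suc i) (ys ! i) (u ! i)))"
    by (simp add: phi_tensor_def sum_distrib_left mult.assoc)
  also have "\<dots> = (\<Sum>ys\<in>?Bn. \<Sum>w\<in>{w. length w = n}.
      t w * (\<Prod>i<n. delta (ys ! i) (ind (w ! i))) * (\<Prod>i<n. phi (Suc i) (ys ! i) (u ! i)))"
    by (rule sum.swap)
  also have "\<dots> = (\<Sum>ys\<in>?Bn. tensor_pairing (map delta ys) t * (\<Prod>i<n. phi (Suc i) (ys ! i) (u ! i)))"
    by (auto simp: tensor_pairing_def sum_distrib_right intro!: sum.cong prod.cong)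
  finally show ?thesis .
qed

lemma tensor_pairing_cop_pow_eq_trace:
  fixes psi :: "(('b::finite \<Rightarrow> complex) \<Rightarrow> complex) \<Rightarrow> complex^'w::finite^'w"
  assumes rep: "is_injective_rep D eps psi" and D: "Vector_Spaces.linear cscale cscale D"
    and bnd: "\<And>g. g \<in> dual_space \<Longrightarrow> trace (bnd ** psi g) = g x"
    and "fs \<noteq> []" and "set fs \<subseteq> dual_space"
  shows "tensor_pairing fs (cop_pow D (length fs - 1) x) = trace (bnd ** foldr (\<lambda>g M. psi g ** M) fs (mat 1))"
proof -
  obtain f fs' where fs: "fs = f # fs'" and f: "f \<in> dual_space" and fs': "set fs' \<subseteq> dual_space"
    using assms(4,5) by (cases fs) auto
  then have "tensor_pairing fs (cop_pow D (length fs - 1) x) = foldl (dual_mult D) f fs' x"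
    using tensor_pairing_cop_pow[OF D] by (simp add: dual_space_def)
  also have "\<dots> = trace (bnd ** psi (foldl (dual_mult D) f fs'))"
    by (rule bnd[OF foldl_dual_mult_in_dual_space[OF D f], symmetric])
  finally show ?thesis
    by (simp add: psi_foldl_dual_mult[OF rep D f fs'] fs)
qed

theorem theorem3p3:
  fixes Delta :: "('b::finite \<Rightarrow> complex) \<Rightarrow> ('b \<times> 'b \<Rightarrow> complex)"
    and eps :: "('b \<Rightarrow> complex) \<Rightarrow> complex"
    and phi :: "nat \<Rightarrow> ('b \<Rightarrow> complex) \<Rightarrow> ('v \<Rightarrow> complex)"
    and S :: "nat \<Rightarrow> 'v set"
    and psi :: "(('b \<Rightarrow> complex) \<Rightarrow> complex) \<Rightarrow> complex^'w::finite^'w"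
    and B :: "('b \<Rightarrow> complex) set"
    and delta :: "('b \<Rightarrow> complex) \<Rightarrow> (('b \<Rightarrow> complex) \<Rightarrow> complex)"
  assumes coalg: "is_coalgebra Delta eps"
    and phi_lin: "\<And>i. i \<ge> 1 \<Longrightarrow> Vector_Spaces.linear cscale cscale (phi i)"
    and V_fin: "\<And>i. i \<ge> 1 \<Longrightarrow> finite (S i)"
    and phi_range: "\<And>i x v. i \<ge> 1 \<Longrightarrow> v \<notin> S i \<Longrightarrow> phi i x v = 0"
    and rep: "is_injective_rep Delta eps psi"
    and B_indep: "module.independent cscale B"
    and B_span: "module.span cscale B = UNIV"
    and delta_dual: "\<And>y. y \<in> B \<Longrightarrow> delta y \<in> dual_space"
    and delta_eval: "\<And>y z. y \<in> B \<Longrightarrow> z \<in> B \<Longrightarrow> delta y z = (if y = z then 1 else 0)"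
  shows "\<forall>x. \<exists>bnd :: complex^'w^'w. \<forall>n \<ge> 1.
           phi_tensor phi n (cop_pow Delta (n - 1) x) = mps phi B (\<lambda>y. psi (delta y)) bnd n"
proof
  \<comment> \<open>\<open>V_fin\<close> and \<open>phi_range\<close> only say that the targets of the \<open>\<phi>\<^sub>i\<close> are finite-dimensional;
    the identity holds without them.\<close>
  fix x
  have D: "Vector_Spaces.linear cscale cscale Delta"
    using coalg by (simp add: is_coalgebra_def)
  obtain bnd :: "complex^'w^'w" where bnd: "\<And>g. g \<in> dual_space \<Longrightarrow> trace (bnd ** psi g) = g x"
    using exists_trace_boundary[OF rep] by blast
  show "\<exists>bnd :: complex^'w^'w. \<forall>n \<ge> 1.
      phi_tensor phi n (cop_pow Delta (n - 1) x) = mps phi B (\<lambda>y. psi (delta y)) bnd n"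
  proof (intro exI allI impI ext)
    fix n :: nat and u assume "n \<ge> 1"
    have "tensor_pairing (map delta ys) (cop_pow Delta (n - 1) x)
        = trace (bnd ** foldr (\<lambda>y M. psi (delta y) ** M) ys (mat 1))"
      if "set ys \<subseteq> B" and "length ys = n" for ys
    proof -
      have "map delta ys \<noteq> []" and "set (map delta ys) \<subseteq> dual_space"
        using that \<open>n \<ge> 1\<close> delta_dual by auto
      from tensor_pairing_cop_pow_eq_trace[OF rep D bnd this] show ?thesis
        using that by (simp add: foldr_map comp_def)
    qed
    then show "phi_tensor phi n (cop_pow Delta (n - 1) x) u = mps phi B (\<lambda>y. psi (delta y)) bnd n u"
      using finite_independent_cscale[OF B_indep]
      by (auto simp: phi_tensor_dual_basis_expansion[OF _ B_span delta_dual delta_eval phi_lin]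
          mps_def intro!: sum.cong)
  qed
qed

end
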